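(* Let $G$ be a compact visibility graph. Then every edge of $G$ is either a bridge of $G$ or lies in a triangle ($K_3$) of $G$.
   Context: All graphs are finite and simple. Given a family of pairwise disjoint nonempty connected subsets ("regions") of $\mathbb{R}^2$, a sightline is a closed line segment $\overline{ab}$ with $a\in A$, $b\in B$ for two different regions $A\neq B$ of the family, such that the segment intersects no region of the family other than $A$ and $B$. A graph $G$ is a visibility graph if there is a family of pairwise disjoint nonempty connected subsets of $\mathbb{R}^2$, one for each vertex of $G$, such that two distinct vertices are adjacent in $G$ if and only if there is a sightline between their regions. $G$ is a compact visibility graph if it has such a representation in which every region is compact (and connected). A bridge is an edge whose removal increases the number of connected components. *)

theory Defs
  imports "HOL-Analysis.Analysis"
begin

text \<open>A finite simple graph: finite vertex set V, symmetric irreflexive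
  edge relation E whose edges lie inside V.\<close>
definition simple_graph :: "'a set \<Rightarrow> ('a \<Rightarrow> 'a \<Rightarrow> bool) \<Rightarrow> bool" where
  "simple_graph V E \<longleftrightarrow> finite V \<and> (\<forall>x y. E x y \<longrightarrow> x \<in> V \<and> y \<in> V \<and> x \<noteq> y \<and> E y x)"

text \<open>Number of connected components.\<close>
definition num_components :: "'a set \<Rightarrow> ('a \<Rightarrow> 'a \<Rightarrow> bool) \<Rightarrow> nat" where
  "num_components V E = card (V // ({(x, y). x \<in> V \<and> y \<in> V \<and> E x y}\<^sup>*))"

definition delete_edge :: "('a \<Rightarrow> 'a \<Rightarrow> bool) \<Rightarrow> 'a \<Rightarrow> 'a \<Rightarrow> ('a \<Rightarrow> 'a \<Rightarrow> bool)" where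
  "delete_edge E u v = (\<lambda>x y. E x y \<and> {x, y} \<noteq> {u, v})"

text \<open>A bridge: an edge whose removal increases the number of components.\<close>
definition is_bridge :: "'a set \<Rightarrow> ('a \<Rightarrow> 'a \<Rightarrow> bool) \<Rightarrow> 'a \<Rightarrow> 'a \<Rightarrow> bool" where
  "is_bridge V E u v \<longleftrightarrow> E u v \<and> num_components V (delete_edge E u v) > num_components V E"

text \<open>Sightline between regions R u and R v (u \<noteq> v) of the family {R w | w \<in> V}.\<close>
definition sightline :: "'a set \<Rightarrow> ('a \<Rightarrow> (real^2) set) \<Rightarrow> 'a \<Rightarrow> 'a \<Rightarrow> real^2 \<Rightarrow> real^2 \<Rightarrow> bool" where
  "sightline V R u v a b \<longleftrightarrow> u \<in> V \<and> v \<in> V \<and> u \<noteq> v \<and> a \<in> R u \<and> b \<in> R v \<and>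
     (\<forall>w\<in>V. w \<noteq> u \<and> w \<noteq> v \<longrightarrow> closed_segment a b \<inter> R w = {})"

definition visibility_representation :: "'a set \<Rightarrow> ('a \<Rightarrow> 'a \<Rightarrow> bool) \<Rightarrow> ('a \<Rightarrow> (real^2) set) \<Rightarrow> bool" where
  "visibility_representation V E R \<longleftrightarrow>
     (\<forall>v\<in>V. R v \<noteq> {} \<and> connected (R v)) \<and>
     (\<forall>u\<in>V. \<forall>v\<in>V. u \<noteq> v \<longrightarrow> R u \<inter> R v = {}) \<and>
     (\<forall>u\<in>V. \<forall>v\<in>V. u \<noteq> v \<longrightarrow> (E u v \<longleftrightarrow> (\<exists>a b. sightline V R u v a b)))"

definition compact_visibility_graph :: "'a set \<Rightarrow> ('a \<Rightarrow> 'a \<Rightarrow> bool) \<Rightarrow> bool" where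
  "compact_visibility_graph V E \<longleftrightarrow> simple_graph V E \<and>
     (\<exists>R. visibility_representation V E R \<and> (\<forall>v\<in>V. compact (R v)))"

end

theory Submission
  imports Defs
begin

text \<open>
  Suppose the edge \<open>uv\<close> lies in no triangle. For points \<open>p, q\<close> of regions let \<open>cross p q\<close> be the parity of the
  number of gaps between \<open>R u\<close> and \<open>R v\<close> along the segment \<open>pq\<close>, a gap being a subsegment with one end in each
  and interior missing all regions. This parity is additive along a segment. It is locally constant in
  \<open>(p, q)\<close>: if a segment moves off a region \<open>R w\<close>, the point of \<open>R w\<close> closest to the moved segment sees both
  neighbouring regions, and the change of parity would need \<open>w\<close> to form a triangle with \<open>u\<close> and \<open>v\<close>. Then
  \<open>cross p r\<close> is the sum of \<open>cross p q\<close> and \<open>cross q r\<close>, since in a violating triple of least perimeter all three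
  segments are sightlines. So \<open>cross\<close> from a base point 2-colours the vertices, and exactly the
  edge \<open>uv\<close> joins different colours, which makes it a bridge.
\<close>

section \<open>Segments and closest points in Euclidean space\<close>

text \<open>The point with the same parameter on the other segment works: the displacement is a
  convex combination of the displacements of the two ends.\<close>

lemma closed_segment_near:
  fixes a b :: "'b::real_normed_vector"
  assumes "dist a a' < e" "dist b b' < e" "z \<in> closed_segment a b"
  shows "\<exists>s\<in>closed_segment a' b'. dist z s < e"
proof -
  obtain t where t: "0 \<le> t" "t \<le> 1" "z = (1 - t) *\<^sub>R a + t *\<^sub>R b"
    using assms(3) by (auto simp: in_segment)
  define s where "s = (1 - t) *\<^sub>R a' + t *\<^sub>R b'"
  have "z - s = (1 - t) *\<^sub>R (a - a') + t *\<^sub>R (b - b')"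
    by (simp add: t s_def algebra_simps)
  then have "norm (z - s) \<le> (1 - t) * dist a a' + t * dist b b'"
    using t norm_triangle_ineq[of "(1 - t) *\<^sub>R (a - a')" "t *\<^sub>R (b - b')"] by (simp add: dist_norm)
  also have "\<dots> < e"
    using convex_bound_lt[of "dist a a'" e "dist b b'" "1 - t" t] assms t by simp
  finally show ?thesis
    using t by (auto simp: s_def dist_norm in_segment intro!: bexI[of _ s])
qed

text \<open>The homothety with centre \<open>p\<close> that takes \<open>c\<close> to
  \<open>z\<close> takes \<open>s\<close> to a point of the segment \<open>p s\<close> and shrinks
  the distance. If \<open>c\<close> and \<open>s\<close> form a closest pair, no other point of the
  segment \<open>p c\<close> can therefore compete with \<open>c\<close>.\<close>

lemma closed_segment_closer:
  fixes p c s :: "'b::real_normed_vector"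
  assumes "z \<in> closed_segment p c" "z \<noteq> c" "c \<noteq> s"
  shows "\<exists>s'\<in>closed_segment p s. dist z s' < dist c s"
proof -
  obtain t where t: "0 \<le> t" "t \<le> 1" "z = (1 - t) *\<^sub>R p + t *\<^sub>R c"
    using assms(1) by (auto simp: in_segment)
  with assms(2) have "t \<noteq> 1" by auto
  with t have t1: "t < 1" by simp
  define s' where "s' = (1 - t) *\<^sub>R p + t *\<^sub>R s"
  have "z - s' = t *\<^sub>R (c - s)"
    by (simp add: t s'_def algebra_simps)
  then have "dist z s' = t * dist c s"
    using t by (simp add: dist_norm)
  also have "\<dots> < dist c s"
    using t1 assms(3) by (simp add: mult_less_cancel_right2)
  finally show ?thesis
    using t by (auto simp: s'_def in_segment intro!: bexI[of _ s'])
qed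

lemma mem_closed_segment_between:
  fixes p q :: "'b::euclidean_space"
  assumes "s \<in> closed_segment p q" "a \<in> closed_segment p s" "b \<in> closed_segment s q"
  shows "s \<in> closed_segment a b"
proof -
  have "between (p, q) s" "between (s, p) a" "between (s, q) b"
    using assms by (auto simp: between_mem_segment closed_segment_commute)
  then show ?thesis
    by (metis between_trans_2 between_mem_segment)
qed

text \<open>Two segments that overlap in more than a point continue each other along one line. This
  turns equality in a triangle inequality into collinearity of \<open>p\<close>, \<open>q\<close>,
  \<open>r\<close>.\<close>

lemma closed_segment_extend:
  fixes p q r s :: "'b::euclidean_space"
  assumes "s \<in> open_segment p q" "q \<in> closed_segment s r"
  shows "q \<in> closed_segment p r"
proof -
  obtain t where t: "0 < t" "t < 1" and s: "s = (1 - t) *\<^sub>R p + t *\<^sub>R q"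
    using assms(1) by (auto simp: in_segment)
  obtain k where k: "0 \<le> k" "k \<le> 1" and q: "q = (1 - k) *\<^sub>R s + k *\<^sub>R r"
    using assms(2) by (auto simp: in_segment)
  \<comment> \<open>Substituting \<open>s\<close> into the expression for \<open>q\<close> leaves
    \<open>q\<close> on both sides; \<open>D\<close> is its coefficient once these terms are
    collected.\<close>
  define D where "D = 1 - (1 - k) * t"
  have "(1 - k) * t \<le> t"
    using t k by (simp add: mult_left_le_one_le)
  then have D: "D > 0"
    unfolding D_def using t by linarith
  have "D *\<^sub>R q = q - ((1 - k) * t) *\<^sub>R q"
    by (simp add: D_def algebra_simps)
  also have "\<dots> = ((1 - k) * (1 - t)) *\<^sub>R p + k *\<^sub>R r"
    by (subst (1) q) (simp add: s scaleR_add_right)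
  also have "(1 - k) * (1 - t) = D - k"
    by (simp add: D_def algebra_simps)
  finally have "q = inverse D *\<^sub>R ((D - k) *\<^sub>R p + k *\<^sub>R r)"
    using D by (simp add: eq_vector_fraction_iff inverse_eq_divide vector_fraction_eq_iff)
  also have "\<dots> = (1 - k / D) *\<^sub>R p + (k / D) *\<^sub>R r"
    using D by (simp add: scaleR_add_right divide_simps)
  finally have "q = (1 - k / D) *\<^sub>R p + (k / D) *\<^sub>R r" .
  moreover have "k \<le> D"
    using \<open>(1 - k) * (1 - t) = D - k\<close> mult_nonneg_nonneg[of "1 - k" "1 - t"] k t by linarith
  ultimately show ?thesis
    using D k by (auto simp: in_segment intro!: exI[of _ "k / D"])
qed

lemma compact_disjoint_gap:
  fixes A B :: "'b::euclidean_space set"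
  assumes "compact A" "compact B" "A \<inter> B = {}"
  shows "\<exists>e>0. \<forall>a\<in>A. \<forall>b\<in>B. e \<le> dist a b"
  using separate_compact_closed[OF assms(1) compact_imp_closed[OF assms(2)] assms(3)] .

text \<open>A pair at minimal distance works, since a point of either set strictly inside the
  segment would form a closer pair with one of the ends.\<close>

lemma closest_pair_segment_gap:
  fixes a0 b0 :: "'b::euclidean_space"
  assumes "compact A" "compact B" "a0 \<in> A" "b0 \<in> B"
  obtains a b where "a \<in> A" "b \<in> B" "open_segment a b \<inter> (A \<union> B) = {}"
proof -
  have "\<exists>z\<in>A \<times> B. \<forall>z'\<in>A \<times> B. dist (fst z) (snd z) \<le> dist (fst z') (snd z')"
    using assms by (intro continuous_attains_inf continuous_intros compact_Times) auto
  then obtain a b where ab: "a \<in> A" "b \<in> B"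
    and min: "\<And>a' b'. a' \<in> A \<Longrightarrow> b' \<in> B \<Longrightarrow> dist a b \<le> dist a' b'"
    by fastforce
  have "z \<notin> A \<union> B" if "z \<in> open_segment a b" for z
  proof -
    have "dist z b < dist a b" "dist a z < dist a b"
      using dist_in_open_segment[OF that] by (simp_all add: dist_commute)
    then show ?thesis using min[of z b] min[of a z] ab by auto
  qed
  then show thesis using that[OF ab] by blast
qed

section \<open>Detecting extra components with a colouring\<close>

text \<open>Sending each component of \<open>E'\<close> to the component of \<open>E\<close>
  containing it is surjective. It is not injective: the components of \<open>u\<close> and
  \<open>v\<close> are merged, but \<open>g\<close>, constant on components of \<open>E'\<close>,
  keeps them distinct.\<close>

lemma num_components_less:
  assumes fin: "finite V" and sub: "\<And>x y. E' x y \<Longrightarrow> E x y"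
    and uv: "u \<in> V" "v \<in> V" "E u v" "E v u"
    and inv: "\<And>x y. x \<in> V \<Longrightarrow> y \<in> V \<Longrightarrow> E' x y \<Longrightarrow> g x = g y" and "g u \<noteq> g v"
  shows "num_components V E < num_components V E'"
proof -
  define r where "r = {(x, y). x \<in> V \<and> y \<in> V \<and> E x y}\<^sup>*"
  define r' where "r' = {(x, y). x \<in> V \<and> y \<in> V \<and> E' x y}\<^sup>*"
  have "r' \<subseteq> r"
    unfolding r_def r'_def using sub by (intro rtrancl_mono) auto
  moreover have "trans r" "refl r" "refl r'"
    by (simp_all add: r_def r'_def trans_rtrancl refl_rtrancl)
  ultimately have im: "r `` (r' `` {x}) = r `` {x}" for x
    unfolding trans_def refl_on_def by blast
  have img: "V // r = (\<lambda>C. r `` C) ` (V // r')"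
    unfolding quotient_def using im by (auto simp: image_UN)
  have fin': "finite (V // r')"
    using fin by (simp add: quotient_def)
  have uv_r: "(u, v) \<in> r" "(v, u) \<in> r"
    unfolding r_def using uv by auto
  then have eq: "r `` {u} = r `` {v}"
    using \<open>trans r\<close> unfolding trans_def by blast
  have not_r': "(u, v) \<notin> r'"
  proof
    assume "(u, v) \<in> r'"
    then have "g u = g v"
      unfolding r'_def by (induction rule: rtrancl_induct) (use inv in auto)
    with \<open>g u \<noteq> g v\<close> show False ..
  qed
  have "\<not> inj_on (\<lambda>C. r `` C) (V // r')"
  proof
    assume "inj_on (\<lambda>C. r `` C) (V // r')"
    moreover have "r' `` {u} \<in> V // r'" "r' `` {v} \<in> V // r'"
      using uv by (auto simp: quotient_def)
    ultimately have "r' `` {u} = r' `` {v}"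
      using im eq unfolding inj_on_def by metis
    moreover have "v \<in> r' `` {v}"
      by (simp add: r'_def)
    ultimately show False
      using not_r' by blast
  qed
  then have "card (V // r) \<noteq> card (V // r')"
    using fin' eq_card_imp_inj_on unfolding img by blast
  moreover have "card (V // r) \<le> card (V // r')"
    unfolding img by (rule card_image_le[OF fin'])
  ultimately show ?thesis
    unfolding num_components_def r_def r'_def by simp
qed

section \<open>Gaps between two regions and their parity\<close>

text \<open>The representation is unpacked in a general Euclidean space. The vertices
  \<open>u\<close> and \<open>v\<close> stand for the ends of an edge that lies in no
  triangle.\<close>

locale sightline_family =
  fixes V :: "'a set" and E :: "'a \<Rightarrow> 'a \<Rightarrow> bool" and R :: "'a \<Rightarrow> 'b::euclidean_space set"
    and u v :: 'a
  assumes finite_V: "finite V"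
    and E_sym: "E x y \<Longrightarrow> E y x"
    and compact_R: "x \<in> V \<Longrightarrow> compact (R x)"
    and connected_R: "x \<in> V \<Longrightarrow> connected (R x)"
    and R_nonempty: "x \<in> V \<Longrightarrow> R x \<noteq> {}"
    and R_disjoint: "x \<in> V \<Longrightarrow> y \<in> V \<Longrightarrow> x \<noteq> y \<Longrightarrow> R x \<inter> R y = {}"
    and E_iff: "x \<in> V \<Longrightarrow> y \<in> V \<Longrightarrow> x \<noteq> y \<Longrightarrow> E x y \<longleftrightarrow>
      (\<exists>a\<in>R x. \<exists>b\<in>R y. \<forall>w\<in>V. w \<noteq> x \<and> w \<noteq> y \<longrightarrow> closed_segment a b \<inter> R w = {})"
    and uv: "u \<in> V" "v \<in> V" "u \<noteq> v"
    and no_triangle: "w \<in> V \<Longrightarrow> \<not> (E u w \<and> E v w)"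
begin

text \<open>The indicator of the pair \<open>{u, v}\<close> is a cocycle modulo 2. If two of the
  vertices coincide, two of the pairs agree and the third is a singleton. If all three are distinct,
  they form a triangle, and none of its edges is \<open>{u, v}\<close>.\<close>

lemma cocycle:
  assumes "x = y \<or> E x y" "x = w \<or> E x w" "y = w \<or> E y w" "x \<in> V" "y \<in> V" "w \<in> V"
  shows "{x, y} = {u, v} \<longleftrightarrow> ({x, w} = {u, v}) \<noteq> ({y, w} = {u, v})"
  using assms no_triangle[of x] no_triangle[of y] no_triangle[of w] E_sym uv(3)
  unfolding doubleton_eq_iff by metis

definition X :: "'b set" where
  "X = (\<Union>w\<in>V. R w)"

text \<open>The end in \<open>R u\<close> is recorded first, whichever end comes first along the
  segment. Hence each gap is counted once, and reversing the segment leaves the set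
  unchanged.\<close>

definition gaps :: "'b \<Rightarrow> 'b \<Rightarrow> ('b \<times> 'b) set" where
  "gaps p q = {(a, b). a \<in> R u \<and> b \<in> R v \<and> a \<in> closed_segment p q \<and> b \<in> closed_segment p q \<and>
     open_segment a b \<inter> X = {}}"

definition cross :: "'b \<Rightarrow> 'b \<Rightarrow> bool" where
  "cross p q \<longleftrightarrow> odd (card (gaps p q))"

lemma R_subset_X: "w \<in> V \<Longrightarrow> R w \<subseteq> X"
  by (auto simp: X_def)

lemma compact_X: "compact X"
  unfolding X_def using finite_V compact_R by blast

lemma R_unique: "x \<in> V \<Longrightarrow> y \<in> V \<Longrightarrow> z \<in> R x \<Longrightarrow> z \<in> R y \<Longrightarrow> x = y"
  using R_disjoint by blast

lemma compact_other_regions: "compact (X - R x)" if "x \<in> V" for x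
proof -
  have "X - R x = (\<Union>w\<in>V - {x}. R w)"
    unfolding X_def using R_unique that by blast
  then show ?thesis using finite_V compact_R by auto
qed

lemma gaps_commute: "gaps p q = gaps q p"
  unfolding gaps_def by (simp add: closed_segment_commute)

lemma cross_commute: "cross p q = cross q p"
  unfolding cross_def by (metis gaps_commute)

lemma gaps_degenerate: "gaps p p = {}"
  using R_unique uv by (auto simp: gaps_def)

text \<open>Every gap is at least as long as the distance between \<open>R u\<close> and
  \<open>R v\<close>, and no gap has an end of another one inside it. So the parameter pairs of the
  gaps form a bounded, uniformly discrete set.\<close>

lemma finite_gaps: "finite (gaps p q)"
proof (cases "p = q")
  case True
  then show ?thesis by (simp add: gaps_degenerate)
next
  case False
  obtain e where e: "e > 0" "\<And>a b. a \<in> R u \<Longrightarrow> b \<in> R v \<Longrightarrow> e \<le> dist a b"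
    using compact_disjoint_gap[of "R u" "R v"] compact_R R_disjoint uv by metis
  define \<phi> where "\<phi> t = (1 - t) *\<^sub>R p + t *\<^sub>R q" for t
  define S where "S = {(s, t). 0 \<le> s \<and> s \<le> 1 \<and> 0 \<le> t \<and> t \<le> 1 \<and> (\<phi> s, \<phi> t) \<in> gaps p q}"
  have dist_\<phi>: "dist (\<phi> s) (\<phi> t) = \<bar>s - t\<bar> * dist p q" for s t
  proof -
    have "\<phi> s - \<phi> t = (s - t) *\<^sub>R (q - p)"
      by (simp add: \<phi>_def algebra_simps)
    then show ?thesis by (simp add: dist_norm norm_minus_commute)
  qed
  have mem_open: "\<phi> m \<in> open_segment (\<phi> s) (\<phi> t)" if "s < m \<and> m < t \<or> t < m \<and> m < s" for s t m
  proof -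
    define k where "k = (m - s) / (t - s)"
    have k: "0 < k" "k < 1" "m = (1 - k) * s + k * t"
      using that by (auto simp: k_def field_simps)
    have "\<phi> m = (1 - k) *\<^sub>R \<phi> s + k *\<^sub>R \<phi> t"
      by (simp add: \<phi>_def k(3) algebra_simps)
    moreover have "\<phi> s \<noteq> \<phi> t"
      using dist_\<phi>[of s t] that False by auto
    ultimately show ?thesis
      using k by (auto simp: in_segment)
  qed
  \<comment> \<open>This is the lower bound \<open>e\<close> on the length of a gap, measured in the
    parameter of \<open>\<phi>\<close>.\<close>
  define \<delta> where "\<delta> = e / dist p q"
  have "\<delta> > 0" using e False by (simp add: \<delta>_def)
  have S: "\<delta> \<le> \<bar>s - t\<bar>" "\<phi> s \<in> X" "\<phi> t \<in> X" "open_segment (\<phi> s) (\<phi> t) \<inter> X = {}"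
    if "(s, t) \<in> S" for s t
  proof -
    have "\<phi> s \<in> R u" "\<phi> t \<in> R v"
      using that by (auto simp: S_def gaps_def)
    then show "\<phi> s \<in> X" "\<phi> t \<in> X" "\<delta> \<le> \<bar>s - t\<bar>"
      using e(2)[of "\<phi> s" "\<phi> t"] R_subset_X uv False by (auto simp: dist_\<phi> \<delta>_def field_simps)
    show "open_segment (\<phi> s) (\<phi> t) \<inter> X = {}"
      using that by (auto simp: S_def gaps_def)
  qed
  have apart: "(s', t') = (s, t)"
    if st: "(s, t) \<in> S" "(s', t') \<in> S" and "norm ((s', t') - (s, t)) < \<delta>" for s t s' t'
  proof -
    have lt: "\<bar>s' - s\<bar> < \<delta>" "\<bar>t' - t\<bar> < \<delta>"
      using that(3) norm_fst_le[of "s' - s" "t' - t"] norm_snd_le[of "t' - t" "s' - s"] by auto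
    \<comment> \<open>Two gaps whose parameters differ by less than \<open>\<delta>\<close> overlap
      and have the same orientation. As neither has an end strictly inside the other, they
      coincide.\<close>
    have out: "\<not> (s < m \<and> m < t \<or> t < m \<and> m < s)" if "m = s' \<or> m = t'" for m
      using mem_open[of s m t] S[OF st(1)] S[OF st(2)] that by blast
    have out': "\<not> (s' < m \<and> m < t' \<or> t' < m \<and> m < s')" if "m = s \<or> m = t" for m
      using mem_open[of s' m t'] S[OF st(1)] S[OF st(2)] that by blast
    show ?thesis
      using lt out[of s'] out[of t'] out'[of s] out'[of t] S(1)[OF st(1)] S(1)[OF st(2)]
      by (smt (verit))
  qed
  have "bounded S"
    by (rule bounded_subset[of "{0..1} \<times> {0..1}"]) (auto simp: S_def intro!: bounded_Times)
  moreover have "uniform_discrete S"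
    unfolding uniform_discrete_def
  proof (intro exI[of _ \<delta>] conjI ballI impI)
    fix x y assume xy: "x \<in> S" "y \<in> S" "dist x y < \<delta>"
    obtain s t s' t' where "x = (s, t)" "y = (s', t')"
      by (cases x, cases y) blast
    with xy show "x = y"
      using apart[of s' t' s t] by (simp add: dist_norm)
  qed (fact \<open>\<delta> > 0\<close>)
  ultimately have "finite S"
    by (simp flip: uniform_discrete_finite_iff)
  moreover have "gaps p q \<subseteq> (\<lambda>(s, t). (\<phi> s, \<phi> t)) ` S"
  proof
    fix z assume z: "z \<in> gaps p q"
    then obtain s t where "0 \<le> s" "s \<le> 1" "0 \<le> t" "t \<le> 1" "z = (\<phi> s, \<phi> t)"
      by (force simp: gaps_def in_segment \<phi>_def)
    with z show "z \<in> (\<lambda>(s, t). (\<phi> s, \<phi> t)) ` S"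
      by (intro image_eqI[of _ _ "(s, t)"]) (auto simp: S_def)
  qed
  ultimately show ?thesis
    using finite_surj by blast
qed

text \<open>No gap can straddle \<open>s\<close>, because its interior would then contain a point of
  \<open>X\<close>. So each gap lies on one side of \<open>s\<close>, and the two sides share only
  \<open>s\<close>.\<close>

lemma gaps_split:
  assumes "s \<in> X" "s \<in> closed_segment p q"
  shows "gaps p q = gaps p s \<union> gaps s q" "gaps p s \<inter> gaps s q = {}"
proof -
  have un: "closed_segment p q = closed_segment p s \<union> closed_segment s q"
    using Un_closed_segment[OF assms(2)] by simp
  have int: "closed_segment p s \<inter> closed_segment s q = {s}"
    using Int_closed_segment assms(2) by blast
  show "gaps p s \<inter> gaps s q = {}"
  proof -
    have "a = s \<and> b = s" if "(a, b) \<in> gaps p s \<inter> gaps s q" for a b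
      using that int by (auto simp: gaps_def)
    moreover have "(s, s) \<notin> gaps p s"
      using R_unique uv by (auto simp: gaps_def)
    ultimately show ?thesis by fast
  qed
  have one_side: "a = s \<or> b = s"
    if "a \<in> closed_segment p s \<and> b \<in> closed_segment s q \<or> b \<in> closed_segment p s \<and> a \<in> closed_segment s q"
      "open_segment a b \<inter> X = {}" for a b
  proof -
    have "s \<in> closed_segment a b"
      using that(1) mem_closed_segment_between[OF assms(2), of a b]
        mem_closed_segment_between[OF assms(2), of b a] closed_segment_commute[of a b] by metis
    then show ?thesis
      using that(2) assms(1) by (auto simp: open_segment_def)
  qed
  show "gaps p q = gaps p s \<union> gaps s q"
  proof
    show "gaps p s \<union> gaps s q \<subseteq> gaps p q"
      unfolding gaps_def un by blast
    show "gaps p q \<subseteq> gaps p s \<union> gaps s q"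
    proof
      fix z assume z: "z \<in> gaps p q"
      obtain a b where ab: "z = (a, b)" by (cases z)
      have "s \<in> closed_segment p s" "s \<in> closed_segment s q" by auto
      with z show "z \<in> gaps p s \<union> gaps s q"
        using one_side[of a b] unfolding gaps_def un ab by blast
    qed
  qed
qed

lemma cross_split:
  assumes "s \<in> X" "s \<in> closed_segment p q"
  shows "cross p q \<longleftrightarrow> cross p s \<noteq> cross s q"
  unfolding cross_def gaps_split(1)[OF assms]
  using card_Un_disjoint[OF finite_gaps finite_gaps gaps_split(2)[OF assms]] by simp

lemma not_cross:
  assumes "closed_segment p q \<inter> R u = {} \<or> closed_segment p q \<inter> R v = {}"
  shows "\<not> cross p q"
proof -
  have "gaps p q = {}" using assms by (auto simp: gaps_def)
  then show ?thesis by (simp add: cross_def)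
qed

lemma cross_gap:
  assumes "a \<in> R u" "b \<in> R v" "open_segment a b \<inter> X = {}"
  shows "cross a b"
proof -
  have "a' = a \<and> b' = b" if "(a', b') \<in> gaps a b" for a' b'
  proof -
    have "a' \<in> R u" "b' \<in> R v" "a' \<in> {a, b}" "b' \<in> {a, b}"
      using that assms(3) R_subset_X uv unfolding gaps_def open_segment_def by blast+
    then show ?thesis using assms R_unique uv by blast
  qed
  moreover have "(a, b) \<in> gaps a b"
    using assms by (auto simp: gaps_def)
  ultimately have "gaps a b = {(a, b)}" by auto
  then show ?thesis by (simp add: cross_def)
qed

section \<open>Segments that meet two regions in separated pieces\<close>

text \<open>A closest pair \<open>a\<close>, \<open>b\<close> on the segment bounds a gap. Convexity
  puts the part from \<open>p\<close> to \<open>a\<close> inside \<open>L\<close> and the part from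
  \<open>b\<close> to \<open>q\<close> inside \<open>H\<close>, so neither contributes. General
  convex sets allow both half-spaces and single points to be used as separators.\<close>

lemma cross_separated:
  assumes pq: "p \<in> R u" "q \<in> R v"
    and LH: "convex L" "convex H" "L \<inter> H = {}"
    and sep: "X \<inter> closed_segment p q \<subseteq> (R u \<inter> L) \<union> (R v \<inter> H)"
  shows "cross p q"
proof -
  have RX: "R u \<subseteq> X" "R v \<subseteq> X" using R_subset_X uv by auto
  have disj: "R u \<inter> R v = {}" using R_disjoint uv by auto
  obtain a b where ab: "a \<in> closed_segment p q" "a \<in> R u" "b \<in> closed_segment p q" "b \<in> R v"
    and gap: "open_segment a b \<inter> (closed_segment p q \<inter> R u \<union> closed_segment p q \<inter> R v) = {}"
    using closest_pair_segment_gap[of "closed_segment p q \<inter> R u" "closed_segment p q \<inter> R v" p q]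
      compact_R uv pq by (metis Int_iff compact_Int compact_segment ends_in_segment)
  have "open_segment a b \<subseteq> closed_segment p q"
    using ab by (meson closed_segment_subset convex_closed_segment segment_open_subset_closed subset_trans)
  then have gap': "open_segment a b \<inter> X = {}"
    using gap sep by blast
  have in_L: "p \<in> L" "a \<in> L" and in_H: "q \<in> H" "b \<in> H"
    using sep pq ab RX disj by auto
  have pa: "closed_segment p a \<subseteq> L" and bq: "closed_segment b q \<subseteq> H"
    using in_L in_H LH by (simp_all add: closed_segment_subset)
  have un: "closed_segment p q = closed_segment p a \<union> closed_segment a q"
    using Un_closed_segment[OF ab(1)] by simp
  \<comment> \<open>The part from \<open>p\<close> to \<open>a\<close> lies in \<open>L\<close> and
    \<open>b\<close> lies in \<open>H\<close>, so \<open>b\<close> comes after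
    \<open>a\<close>.\<close>
  have b_aq: "b \<in> closed_segment a q"
    using un ab(3) pa in_H LH(3) by blast
  have sub: "closed_segment p a \<subseteq> closed_segment p q" "closed_segment b q \<subseteq> closed_segment p q"
    using ab by (auto simp: subset_closed_segment)
  have R_L: "z \<in> L" if "z \<in> R u" "z \<in> closed_segment p q" for z
    using sep that RX disj by blast
  have R_H: "z \<in> H" if "z \<in> R v" "z \<in> closed_segment p q" for z
    using sep that RX disj by blast
  have "closed_segment p a \<inter> R v = {}"
    using pa LH(3) sub(1) R_H by blast
  then have "\<not> cross p a"
    by (intro not_cross) simp
  moreover have "closed_segment b q \<inter> R u = {}"
    using bq LH(3) sub(2) R_L by blast
  then have "\<not> cross b q"
    by (intro not_cross) simp
  moreover have "cross a b"
    using ab gap' by (intro cross_gap) auto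
  moreover have "cross p q \<longleftrightarrow> cross p a \<noteq> cross a q"
    using ab RX by (intro cross_split) auto
  moreover have "cross a q \<longleftrightarrow> cross a b \<noteq> cross b q"
    using ab b_aq RX by (intro cross_split) auto
  ultimately show ?thesis by blast
qed

text \<open>The segment meets only \<open>R x\<close> and \<open>R y\<close>, so it is a sightline
  unless \<open>x = y\<close>. If \<open>{x, y}\<close> is \<open>{u, v}\<close>, the previous lemma
  applies in one of the two directions; otherwise the segment misses \<open>R u\<close> or
  \<open>R v\<close>.\<close>

lemma visible_separated:
  assumes xy: "x \<in> V" "y \<in> V" "p \<in> R x" "q \<in> R y"
    and LH: "convex L" "convex H" "L \<inter> H = {}"
    and sep: "X \<inter> closed_segment p q \<subseteq> (R x \<inter> L) \<union> (R y \<inter> H)"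
  shows "x = y \<or> E x y" "cross p q \<longleftrightarrow> {x, y} = {u, v}"
proof -
  have meet: "w = x \<or> w = y" if "w \<in> V" "z \<in> closed_segment p q" "z \<in> R w" for w z
  proof -
    have "z \<in> R x \<or> z \<in> R y"
      using sep that R_subset_X by blast
    then show ?thesis using R_unique that xy by metis
  qed
  show "x = y \<or> E x y"
    using E_iff[of x y] xy meet by blast
  show "cross p q \<longleftrightarrow> {x, y} = {u, v}"
  proof (cases "{x, y} = {u, v}")
    case True
    then consider "x = u" "y = v" | "x = v" "y = u"
      by (auto simp: doubleton_eq_iff)
    then have "cross p q"
    proof cases
      case 1
      then show ?thesis using cross_separated[of p q L H] xy LH sep by blast
    next
      case 2
      have "cross q p"
        using cross_separated[of q p H L] 2 xy LH sep
        by (simp add: closed_segment_commute Int_commute Un_commute)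
      then show ?thesis by (simp add: cross_commute)
    qed
    with True show ?thesis by simp
  next
    case False
    have "closed_segment p q \<inter> R u = {} \<or> closed_segment p q \<inter> R v = {}"
    proof (rule ccontr)
      assume "\<not> ?thesis"
      then have "u = x \<or> u = y" "v = x \<or> v = y"
        using meet uv by blast+
      with False uv show False by auto
    qed
    then have "\<not> cross p q"
      by (rule not_cross)
    with False show ?thesis by simp
  qed
qed

section \<open>Local constancy of the parity\<close>

lemma region_nbhd:
  assumes "x \<in> V" "p \<in> R x"
  obtains e where "e > 0" "\<And>z. z \<in> X \<Longrightarrow> dist p z < e \<Longrightarrow> z \<in> R x"
proof -
  obtain e where "e > 0" "\<And>a b. a \<in> {p} \<Longrightarrow> b \<in> X - R x \<Longrightarrow> e \<le> dist a b"
    using compact_disjoint_gap[of "{p}" "X - R x"] compact_other_regions assms by auto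
  then show thesis
    using that[of e] by force
qed

text \<open>As a union of open sets this is open, so the pairs where \<open>cross\<close> fails to be locally constant form a
  compact subset of \<open>X \<times> X\<close>, in which a pair at minimal distance exists.\<close>
definition locally_const :: "('b \<times> 'b) set" where
  "locally_const = \<Union>{U. open U \<and> (\<exists>k. \<forall>(p, q)\<in>U \<inter> X \<times> X. cross p q = k)}"

lemma open_locally_const: "open locally_const"
  unfolding locally_const_def by blast

lemma eventually_cross_eq:
  assumes "(p, q) \<in> locally_const" "p \<in> X" "q \<in> X"
    and "(P \<longlongrightarrow> p) G" "(Q \<longlongrightarrow> q) G"
    and PQX: "\<forall>\<^sub>F n in G. P n \<in> X" "\<forall>\<^sub>F n in G. Q n \<in> X"
  shows "\<forall>\<^sub>F n in G. cross (P n) (Q n) = cross p q"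
proof -
  obtain U k where U: "open U" "(p, q) \<in> U" "\<forall>(p, q)\<in>U \<inter> X \<times> X. cross p q = k"
    using assms(1) by (auto simp: locally_const_def)
  have "((\<lambda>n. (P n, Q n)) \<longlongrightarrow> (p, q)) G"
    using assms by (intro tendsto_Pair)
  then have "\<forall>\<^sub>F n in G. (P n, Q n) \<in> U"
    using U(1,2) by (rule topological_tendstoD)
  with PQX show ?thesis
  proof eventually_elim
    case (elim n)
    then show ?case
      using bspec[OF U(3), of "(p, q)"] bspec[OF U(3), of "(P n, Q n)"] U(2) assms by simp
  qed
qed

lemma not_locally_const_sequence:
  assumes "(p, q) \<notin> locally_const"
  obtains P Q :: "nat \<Rightarrow> 'b" where "P \<longlonglongrightarrow> p" "Q \<longlonglongrightarrow> q" "\<And>n. P n \<in> X" "\<And>n. Q n \<in> X"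
    "\<And>n. cross (P n) (Q n) \<noteq> cross p q"
proof -
  have "\<exists>p' q'. p' \<in> X \<and> q' \<in> X \<and> dist p p' < inverse (Suc n) \<and> dist q q' < inverse (Suc n) \<and>
      cross p' q' \<noteq> cross p q" for n
  proof (rule ccontr)
    let ?U = "ball p (inverse (Suc n)) \<times> ball q (inverse (Suc n))"
    assume "\<not> ?thesis"
    then have "\<forall>(p', q')\<in>?U \<inter> X \<times> X. cross p' q' = cross p q"
      by auto
    moreover have "open ?U" "(p, q) \<in> ?U"
      by (auto intro!: open_Times)
    ultimately show False
      using assms unfolding locally_const_def by blast
  qed
  then obtain P Q where PQ: "\<And>n. P n \<in> X" "\<And>n. Q n \<in> X" "\<And>n. cross (P n) (Q n) \<noteq> cross p q"
    "\<And>n. dist p (P n) < inverse (Suc n)" "\<And>n. dist q (Q n) < inverse (Suc n)"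
    by metis
  have "P \<longlonglongrightarrow> p" "Q \<longlonglongrightarrow> q"
    by (rule metric_tendsto_imp_tendsto[OF LIMSEQ_inverse_real_of_nat];
        use PQ in \<open>auto simp: dist_commute intro!: less_imp_le always_eventually\<close>)+
  with PQ show thesis by (intro that)
qed

text \<open>A sufficiently short segment near \<open>p\<close> meets only the region of
  \<open>p\<close>, so it misses \<open>R u\<close> or \<open>R v\<close> and has no gaps.\<close>

lemma locally_const_diagonal:
  assumes "p \<in> X"
  shows "(p, p) \<in> locally_const"
proof (rule ccontr)
  assume "(p, p) \<notin> locally_const"
  then obtain P Q :: "nat \<Rightarrow> 'b" where PQ: "P \<longlonglongrightarrow> p" "Q \<longlonglongrightarrow> p" "\<And>n. P n \<in> X" "\<And>n. Q n \<in> X"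
    "\<And>n. cross (P n) (Q n) \<noteq> cross p p"
    using not_locally_const_sequence by metis
  obtain x where x: "x \<in> V" "p \<in> R x"
    using assms by (auto simp: X_def)
  obtain e where e: "e > 0" "\<And>z. z \<in> X \<Longrightarrow> dist p z < e \<Longrightarrow> z \<in> R x"
    using region_nbhd x by blast
  have "\<forall>\<^sub>F n in sequentially. dist (P n) p < e \<and> dist (Q n) p < e"
    using PQ e by (intro eventually_conj tendstoD) auto
  then obtain n where n: "dist (P n) p < e" "dist (Q n) p < e"
    using eventually_happens'[OF sequentially_bot] by blast
  have "closed_segment (P n) (Q n) \<subseteq> ball p e"
    using n by (intro closed_segment_subset convex_ball) (auto simp: dist_commute)
  then have "w = x" if "w \<in> V" "z \<in> closed_segment (P n) (Q n)" "z \<in> R w" for w z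
    using that e(2)[of z] x R_unique[of w x z] R_subset_X[of w] by (auto dest!: subsetD)
  then have "closed_segment (P n) (Q n) \<inter> R u = {} \<or> closed_segment (P n) (Q n) \<inter> R v = {}"
    using uv by blast
  then have "\<not> cross (P n) (Q n)"
    by (rule not_cross)
  moreover have "\<not> cross p p"
    by (simp add: cross_def gaps_degenerate)
  ultimately show False
    using PQ(5) by blast
qed

text \<open>Suppose perturbed pairs \<open>P n\<close>, \<open>Q n\<close> keep the wrong parity. If
  only the regions of \<open>p\<close> and \<open>q\<close> are met, near the respective ends, both
  parities are the indicator of the same pair of regions. Otherwise the closest points
  \<open>C n\<close> accumulate at an inner point \<open>c\<close> of the segment, where the
  hypothesis and additivity apply. If \<open>C n\<close> is off the perturbed segment, it forms with
  \<open>P n\<close> and \<open>Q n\<close> a triangle with clear sides, and \<open>cocycle\<close>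
  gives the contradiction.\<close>

lemma locally_const_if_inner:
  assumes pq: "p \<in> X" "q \<in> X" "p \<noteq> q"
    and inner: "\<And>c. c \<in> X \<Longrightarrow> c \<in> open_segment p q \<Longrightarrow>
      (p, c) \<in> locally_const \<and> (c, q) \<in> locally_const"
  shows "(p, q) \<in> locally_const"
proof (rule ccontr)
  assume "(p, q) \<notin> locally_const"
  then obtain P Q :: "nat \<Rightarrow> 'b" where P: "P \<longlonglongrightarrow> p" "\<And>n. P n \<in> X"
    and Q: "Q \<longlonglongrightarrow> q" "\<And>n. Q n \<in> X"
    and PQ: "\<And>n. cross (P n) (Q n) \<noteq> cross p q"
    using not_locally_const_sequence by metis
  obtain x where x: "x \<in> V" "p \<in> R x"
    using pq by (auto simp: X_def)
  obtain y where y: "y \<in> V" "q \<in> R y"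
    using pq by (auto simp: X_def)
  obtain e1 where e1: "e1 > 0" "\<And>z. z \<in> X \<Longrightarrow> dist p z < e1 \<Longrightarrow> z \<in> R x"
    using region_nbhd x by blast
  obtain e2 where e2: "e2 > 0" "\<And>z. z \<in> X \<Longrightarrow> dist q z < e2 \<Longrightarrow> z \<in> R y"
    using region_nbhd y by blast
  define d where "d = q - p"
  have d: "d \<noteq> 0" "d \<bullet> d > 0" using pq by (auto simp: d_def)
  \<comment> \<open>The pieces of relative length \<open>\<tau>\<close> at the two ends stay inside
    the neighbourhoods of \<open>p\<close> and \<open>q\<close>. The bound \<open>1/3\<close> leaves
    a proper middle part.\<close>
  define \<tau> where "\<tau> = min (1/3) (min e1 e2 / (2 * norm d))"
  have \<tau>: "0 < \<tau>" "\<tau> < 1/2" "\<tau> * norm d < e1" "\<tau> * norm d < e2"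
  proof -
    have "\<tau> * norm d \<le> min e1 e2 / 2"
      using d(1) mult_right_mono[of \<tau> "min e1 e2 / (2 * norm d)" "norm d"] by (simp add: \<tau>_def)
    then show "\<tau> * norm d < e1" "\<tau> * norm d < e2"
      using e1(1) e2(1) by linarith+
    show "0 < \<tau>" "\<tau> < 1/2"
      using e1(1) e2(1) d by (auto simp: \<tau>_def min_def)
  qed
  \<comment> \<open>\<open>\<alpha>\<close> and \<open>\<beta>\<close> are the heights in direction
    \<open>d\<close> of the points of the segment with parameters \<open>\<tau>\<close> and
    \<open>1 - \<tau>\<close>. They bound the slab that is treated as the middle.\<close>
  define \<alpha> where "\<alpha> = p \<bullet> d + \<tau> * (d \<bullet> d)"
  define \<beta> where "\<beta> = p \<bullet> d + (1 - \<tau>) * (d \<bullet> d)"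
  have \<alpha>\<beta>: "p \<bullet> d < \<alpha>" "\<alpha> < \<beta>" "\<beta> < q \<bullet> d"
  proof -
    have "q \<bullet> d = p \<bullet> d + d \<bullet> d"
      by (simp add: d_def algebra_simps)
    then show "p \<bullet> d < \<alpha>" "\<alpha> < \<beta>" "\<beta> < q \<bullet> d"
      using d \<tau> by (simp_all add: \<alpha>_def \<beta>_def algebra_simps)
  qed
  have ends: "z \<bullet> d \<le> \<alpha> \<Longrightarrow> z \<in> R x" "\<beta> \<le> z \<bullet> d \<Longrightarrow> z \<in> R y"
    if z: "z \<in> X" "z \<in> closed_segment p q" for z
  proof -
    obtain t where t: "0 \<le> t" "t \<le> 1" "z = (1 - t) *\<^sub>R p + t *\<^sub>R q"
      using z(2) by (auto simp: in_segment)
    have zt: "z - p = t *\<^sub>R d" "q - z = (1 - t) *\<^sub>R d"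
      by (simp_all add: t d_def algebra_simps)
    have zd: "z \<bullet> d = p \<bullet> d + t * (d \<bullet> d)"
      by (simp add: t d_def algebra_simps)
    have dist_z: "dist p z = t * norm d" "dist q z = (1 - t) * norm d"
      using zt t(1,2) by (simp_all add: dist_norm norm_minus_commute[of p z])
    show "z \<in> R x" if "z \<bullet> d \<le> \<alpha>"
    proof -
      have "t \<le> \<tau>" using that d by (simp add: zd \<alpha>_def)
      then have "t * norm d \<le> \<tau> * norm d" by (rule mult_right_mono) simp
      then have "dist p z < e1"
        using \<tau> by (simp add: dist_z)
      then show ?thesis using e1 z by blast
    qed
    show "z \<in> R y" if "\<beta> \<le> z \<bullet> d"
    proof -
      have "1 - t \<le> \<tau>" using that d by (simp add: zd \<beta>_def)
      then have "(1 - t) * norm d \<le> \<tau> * norm d" by (rule mult_right_mono) simp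
      then have "dist q z < e2"
        using \<tau> by (simp add: dist_z)
      then show ?thesis using e2 z by blast
    qed
  qed
  have closed_le: "closed {z. z \<bullet> d \<le> c}" "closed {z. c \<le> z \<bullet> d}" for c
    using closed_halfspace_le[of d c] closed_halfspace_ge[of c d] by (simp_all add: inner_commute)
  have conv: "convex {z. z \<bullet> d < c}" "convex {z. c < z \<bullet> d}" "convex {z. z \<bullet> d \<le> c}"
    "convex {z. c \<le> z \<bullet> d}" for c
    using convex_halfspace_lt[of d c] convex_halfspace_gt[of c d] convex_halfspace_le[of d c]
      convex_halfspace_ge[of c d] by (simp_all add: inner_commute)
  \<comment> \<open>\<open>?K\<close> collects the points of wrong regions beyond either side of the
    slab. It is compact and misses the segment, so points of \<open>X\<close> outside the slab and
    within \<open>e3\<close> of the segment belong to \<open>R x\<close> or \<open>R y\<close>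
    according to the side.\<close>
  have "compact ((X - R x) \<inter> {z. z \<bullet> d \<le> \<alpha>} \<union> (X - R y) \<inter> {z. \<beta> \<le> z \<bullet> d})" (is "compact ?K")
    using compact_other_regions x y closed_le by (intro compact_Un compact_Int_closed) auto
  moreover have "?K \<inter> closed_segment p q = {}"
    using ends by blast
  ultimately obtain e3 where e3: "e3 > 0" "\<And>a b. a \<in> ?K \<Longrightarrow> b \<in> closed_segment p q \<Longrightarrow> e3 \<le> dist a b"
    using compact_disjoint_gap[OF _ compact_segment] by meson
  have near: "z \<bullet> d \<le> \<alpha> \<Longrightarrow> z \<in> R x" "\<beta> \<le> z \<bullet> d \<Longrightarrow> z \<in> R y"
    if "z \<in> X" "s \<in> closed_segment p q" "dist z s < e3" for z s
    using e3(2)[of z s] that by force+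
  \<comment> \<open>The slab keeps away from the ends of the segment; \<open>C n\<close> below is a point of \<open>M\<close> closest to the
    perturbed segment, so segments from its ends to \<open>C n\<close> meet \<open>M\<close> only in \<open>C n\<close>.\<close>
  define M where "M = X \<inter> {z. \<alpha> \<le> z \<bullet> d} \<inter> {z. z \<bullet> d \<le> \<beta>}"
  have "compact M"
    unfolding M_def using compact_X closed_le by (intro compact_Int_closed)
  have M_open: "c \<in> open_segment p q" if "c \<in> M" "c \<in> closed_segment p q" for c
    using that \<alpha>\<beta> by (auto simp: M_def open_segment_def)
  have ev_close: "\<forall>\<^sub>F n in sequentially. dist (P n) p < e \<and> dist (Q n) q < e" if "e > 0" for e
    using P(1) Q(1) that by (intro eventually_conj tendstoD)
  have ev_ends: "\<forall>\<^sub>F n in sequentially. P n \<bullet> d < \<alpha> \<and> \<beta> < Q n \<bullet> d"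
  proof (intro eventually_conj)
    show "\<forall>\<^sub>F n in sequentially. P n \<bullet> d < \<alpha>"
      using tendsto_inner[OF P(1) tendsto_const] \<alpha>\<beta>(1) by (rule order_tendstoD(2))
    show "\<forall>\<^sub>F n in sequentially. \<beta> < Q n \<bullet> d"
      using tendsto_inner[OF Q(1) tendsto_const] \<alpha>\<beta>(3) by (rule order_tendstoD(1))
  qed
  have P_region: "P n \<in> R x" "Q n \<in> R y"
    if "dist (P n) p < e3" "dist (Q n) q < e3" "P n \<bullet> d < \<alpha>" "\<beta> < Q n \<bullet> d" for n
    using near[of "P n" p] near[of "Q n" q] that P(2) Q(2) by auto
  have PQ_clear: "X \<inter> closed_segment (P n) (Q n) \<subseteq> (R x \<inter> {z. z \<bullet> d < \<alpha>}) \<union> (R y \<inter> {z. \<alpha> \<le> z \<bullet> d})"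
    if n: "dist (P n) p < e3" "dist (Q n) q < e3" and M0: "M \<inter> closed_segment (P n) (Q n) = {}" for n
  proof
    fix z assume z: "z \<in> X \<inter> closed_segment (P n) (Q n)"
    obtain s where s: "s \<in> closed_segment p q" "dist z s < e3"
      using closed_segment_near[OF n, of z] z by blast
    have "z \<notin> M" using M0 z by blast
    with z consider "z \<bullet> d < \<alpha>" | "\<beta> < z \<bullet> d"
      by (fastforce simp: M_def)
    then show "z \<in> (R x \<inter> {z. z \<bullet> d < \<alpha>}) \<union> (R y \<inter> {z. \<alpha> \<le> z \<bullet> d})"
      using near[of z s] s z \<alpha>\<beta> by cases auto
  qed
  have lh: "{z. z \<bullet> d < c} \<inter> {z. c \<le> z \<bullet> d} = {}" "{z. c < z \<bullet> d} \<inter> {z. z \<bullet> d \<le> c} = {}" for c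
    by auto
  show False
  proof (cases "M \<inter> closed_segment p q = {}")
    case True
    then obtain e4 where e4: "e4 > 0" "\<And>a b. a \<in> M \<Longrightarrow> b \<in> closed_segment p q \<Longrightarrow> e4 \<le> dist a b"
      using compact_disjoint_gap[OF \<open>compact M\<close> compact_segment] by meson
    have "\<forall>\<^sub>F n in sequentially. (dist (P n) p < min e3 e4 \<and> dist (Q n) q < min e3 e4) \<and>
        (P n \<bullet> d < \<alpha> \<and> \<beta> < Q n \<bullet> d)"
      using e3 e4 by (intro eventually_conj ev_close ev_ends) simp
    then obtain n where n: "dist (P n) p < min e3 e4" "dist (Q n) q < min e3 e4"
      "P n \<bullet> d < \<alpha>" "\<beta> < Q n \<bullet> d"
      using eventually_happens'[OF sequentially_bot] by blast
    have M0: "M \<inter> closed_segment (P n) (Q n) = {}"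
      using closed_segment_near[of "P n" p e4 "Q n" q] n e4(2) by force
    have "cross (P n) (Q n) \<longleftrightarrow> {x, y} = {u, v}"
      using n M0 P_region PQ_clear
      by (intro visible_separated(2)[OF x(1) y(1) _ _ conv(1,4)[of \<alpha>] lh(1)]) auto
    moreover have "X \<inter> closed_segment p q \<subseteq> (R x \<inter> {z. z \<bullet> d < \<alpha>}) \<union> (R y \<inter> {z. \<alpha> \<le> z \<bullet> d})"
    proof
      fix z assume z: "z \<in> X \<inter> closed_segment p q"
      with True consider "z \<bullet> d < \<alpha>" | "\<beta> < z \<bullet> d"
        by (fastforce simp: M_def)
      then show "z \<in> (R x \<inter> {z. z \<bullet> d < \<alpha>}) \<union> (R y \<inter> {z. \<alpha> \<le> z \<bullet> d})"
        using ends[of z] z \<alpha>\<beta> by cases auto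
    qed
    then have "cross p q \<longleftrightarrow> {x, y} = {u, v}"
      by (intro visible_separated(2)[OF x(1) y(1) x(2) y(2) conv(1,4)[of \<alpha>] lh(1)])
    ultimately show False
      using PQ by blast
  next
    case False
    then obtain s0 where s0: "s0 \<in> M" "s0 \<in> closed_segment p q" by blast
    have "\<exists>c\<in>M. \<exists>s\<in>closed_segment (P n) (Q n). \<forall>c'\<in>M. \<forall>s'\<in>closed_segment (P n) (Q n).
        dist c s \<le> dist c' s'" for n
    proof -
      have "\<exists>z\<in>M \<times> closed_segment (P n) (Q n). \<forall>z'\<in>M \<times> closed_segment (P n) (Q n).
          dist (fst z) (snd z) \<le> dist (fst z') (snd z')"
        using \<open>compact M\<close> s0(1)
        by (intro continuous_attains_inf continuous_intros compact_Times compact_segment) auto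
      then show ?thesis by fastforce
    qed
    then obtain C S where C: "\<And>n. C n \<in> M" and S: "\<And>n. S n \<in> closed_segment (P n) (Q n)"
      and min: "\<And>n c' s'. c' \<in> M \<Longrightarrow> s' \<in> closed_segment (P n) (Q n) \<Longrightarrow> dist (C n) (S n) \<le> dist c' s'"
      by metis
    \<comment> \<open>The point \<open>s0\<close> of \<open>M\<close> on the original segment is
      within \<open>e\<close> of the perturbed one, so the minimal distance is below
      \<open>e\<close>. Returning from \<open>S n\<close> to the original segment costs another
      \<open>e\<close>.\<close>
    have C_near: "\<exists>s\<in>closed_segment p q. dist (C n) s < 2 * e"
      if n: "dist (P n) p < e" "dist (Q n) q < e" for n e
    proof -
      obtain s where s: "s \<in> closed_segment (P n) (Q n)" "dist s0 s < e"
        using closed_segment_near[of p "P n" e q "Q n" s0] n s0(2) by (auto simp: dist_commute)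
      then have "dist (C n) (S n) < e"
        using min[OF s0(1) s(1)] by simp
      moreover obtain s' where "s' \<in> closed_segment p q" "dist (S n) s' < e"
        using closed_segment_near[OF n S] by blast
      ultimately show ?thesis
        using dist_triangle[of "C n" s' "S n"] by (intro bexI[of _ s']) auto
    qed
    obtain c r where c: "c \<in> M" "strict_mono r" "(C \<circ> r) \<longlonglongrightarrow> c"
      using \<open>compact M\<close> C unfolding compact_def by meson
    \<comment> \<open>By \<open>C_near\<close> the distance from \<open>C n\<close> to the original
      segment tends to 0, and the segment is closed.\<close>
    have c_seg: "c \<in> closed_segment p q"
    proof (rule ccontr)
      assume "c \<notin> closed_segment p q"
      then obtain e where e: "e > 0" "\<And>b. b \<in> closed_segment p q \<Longrightarrow> e \<le> dist c b"
        using compact_disjoint_gap[of "{c}" "closed_segment p q"] by auto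
      have "\<forall>\<^sub>F n in sequentially. dist (P (r n)) p < e / 4 \<and> dist (Q (r n)) q < e / 4"
        using eventually_subseq[OF c(2) ev_close[of "e / 4"]] e by simp
      moreover have "\<forall>\<^sub>F n in sequentially. dist ((C \<circ> r) n) c < e / 2"
        using tendstoD[OF c(3), of "e / 2"] e by simp
      ultimately have "\<forall>\<^sub>F n in sequentially. (dist (P (r n)) p < e / 4 \<and> dist (Q (r n)) q < e / 4) \<and>
          dist ((C \<circ> r) n) c < e / 2"
        by (rule eventually_conj)
      then obtain n where n: "dist (P (r n)) p < e / 4" "dist (Q (r n)) q < e / 4" "dist (C (r n)) c < e / 2"
        using eventually_happens'[OF sequentially_bot] by fastforce
      obtain s where "s \<in> closed_segment p q" "dist (C (r n)) s < e / 2"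
        using C_near[OF n(1,2)] by auto
      with n(3) e(2)[of s] show False
        using dist_triangle3[of c s "C (r n)"] by simp
    qed
    have cX: "c \<in> X" and CX: "\<And>n. C n \<in> X"
      using c(1) C by (auto simp: M_def)
    have lc: "(p, c) \<in> locally_const" "(c, q) \<in> locally_const"
      using inner[OF cX M_open[OF c(1) c_seg]] by auto
    have Pr: "(\<lambda>n. P (r n)) \<longlonglongrightarrow> p" and Qr: "(\<lambda>n. Q (r n)) \<longlonglongrightarrow> q" and Cr: "(\<lambda>n. C (r n)) \<longlonglongrightarrow> c"
      using LIMSEQ_subseq_LIMSEQ[OF P(1) c(2)] LIMSEQ_subseq_LIMSEQ[OF Q(1) c(2)] c(3)
      by (simp_all add: o_def)
    have "\<forall>\<^sub>F n in sequentially. ((dist (P (r n)) p < e3 / 2 \<and> dist (Q (r n)) q < e3 / 2) \<and>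
        (P (r n) \<bullet> d < \<alpha> \<and> \<beta> < Q (r n) \<bullet> d)) \<and>
        (cross (P (r n)) (C (r n)) = cross p c \<and> cross (C (r n)) (Q (r n)) = cross c q)"
      using e3 P(2) Q(2) CX Pr Qr Cr cX pq lc
      by (intro eventually_conj eventually_subseq[OF c(2) ev_close] eventually_subseq[OF c(2) ev_ends]
          eventually_cross_eq) auto
    then obtain n where n: "dist (P (r n)) p < e3 / 2" "dist (Q (r n)) q < e3 / 2"
      "P (r n) \<bullet> d < \<alpha>" "\<beta> < Q (r n) \<bullet> d"
      "cross (P (r n)) (C (r n)) = cross p c" "cross (C (r n)) (Q (r n)) = cross c q"
      using eventually_happens'[OF sequentially_bot] by blast
    define m where "m = r n"
    note n = n[folded m_def]
    \<comment> \<open>Splitting at \<open>c\<close> gives the parity of \<open>p q\<close>, and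
      local constancy on both halves transfers it to the perturbed halves meeting at
      \<open>C m\<close>.\<close>
    have cross_pq: "cross p q \<longleftrightarrow> cross (P m) (C m) \<noteq> cross (C m) (Q m)"
      using cross_split[OF cX c_seg] n by simp
    have n3: "dist (P m) p < e3" "dist (Q m) q < e3"
      using n e3(1) by linarith+
    show False
    proof (cases "C m \<in> closed_segment (P m) (Q m)")
      case True
      then show False
        using cross_split[OF CX True] cross_pq PQ by blast
    next
      case False
      then have "C m \<noteq> S m" using S by metis
      have PR: "P m \<in> R x" "Q m \<in> R y"
        using P_region n3 n by blast+
      obtain w where w: "w \<in> V" "C m \<in> R w"
        using CX by (auto simp: X_def)
      have M0: "M \<inter> closed_segment (P m) (Q m) = {}"
        using min[of _ _ m] \<open>C m \<noteq> S m\<close> by force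
      \<comment> \<open>The ends were required to move by less than \<open>e3 / 2\<close> because
        \<open>C_near\<close> doubles this bound.\<close>
      obtain s1 where s1: "s1 \<in> closed_segment p q" "dist (C m) s1 < e3"
        using C_near[OF n(1,2)] by auto
      have not_M: "z \<notin> M" if zA: "z \<in> closed_segment A (C m)" "z \<noteq> C m" "A \<in> {P m, Q m}" for z A
      proof -
        obtain s' where "s' \<in> closed_segment A (S m)" "dist z s' < dist (C m) (S m)"
          using closed_segment_closer[OF zA(1,2) \<open>C m \<noteq> S m\<close>] by blast
        moreover have "closed_segment A (S m) \<subseteq> closed_segment (P m) (Q m)"
          using S zA(3) by (auto simp: subset_closed_segment)
        ultimately show ?thesis
          using min[of z s' m] by force
      qed
      have CM: "\<alpha> \<le> C m \<bullet> d" "C m \<bullet> d \<le> \<beta>"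
        using C[of m] by (auto simp: M_def)
      \<comment> \<open>This segment stays below \<open>\<beta>\<close> and meets \<open>M\<close>
        only at \<open>C m\<close>, so its other points in \<open>X\<close> lie below
        \<open>\<alpha>\<close>. They are also within \<open>e3\<close> of the original segment,
        hence in \<open>R x\<close>. The segment from \<open>Q m\<close> is handled symmetrically
        with \<open>\<beta>\<close>.\<close>
      have sepP: "X \<inter> closed_segment (P m) (C m) \<subseteq> (R x \<inter> {z. z \<bullet> d < \<alpha>}) \<union> (R w \<inter> {z. \<alpha> \<le> z \<bullet> d})"
      proof
        fix z assume z: "z \<in> X \<inter> closed_segment (P m) (C m)"
        have "closed_segment p s1 \<subseteq> closed_segment p q"
          using s1 by (auto simp: subset_closed_segment)
        then obtain s where s: "s \<in> closed_segment p q" "dist z s < e3"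
          using closed_segment_near[OF n3(1) s1(2), of z] z by blast
        have "closed_segment (P m) (C m) \<subseteq> {z. z \<bullet> d \<le> \<beta>}"
          using CM n \<alpha>\<beta> conv(3) by (intro closed_segment_subset) auto
        then have "z \<bullet> d \<le> \<beta>" using z by blast
        then have "z \<bullet> d < \<alpha> \<or> z = C m"
          using not_M[of z "P m"] z by (auto simp: M_def)
        then show "z \<in> (R x \<inter> {z. z \<bullet> d < \<alpha>}) \<union> (R w \<inter> {z. \<alpha> \<le> z \<bullet> d})"
          using near(1)[of z s] s z w CM by auto
      qed
      have sepQ: "X \<inter> closed_segment (Q m) (C m) \<subseteq> (R y \<inter> {z. \<beta> < z \<bullet> d}) \<union> (R w \<inter> {z. z \<bullet> d \<le> \<beta>})"
      proof
        fix z assume z: "z \<in> X \<inter> closed_segment (Q m) (C m)"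
        have "closed_segment q s1 \<subseteq> closed_segment p q"
          using s1 by (auto simp: subset_closed_segment)
        then obtain s where s: "s \<in> closed_segment p q" "dist z s < e3"
          using closed_segment_near[OF n3(2) s1(2), of z] z by blast
        have "closed_segment (Q m) (C m) \<subseteq> {z. \<alpha> \<le> z \<bullet> d}"
          using CM n \<alpha>\<beta> conv(4) by (intro closed_segment_subset) auto
        then have "\<alpha> \<le> z \<bullet> d" using z by blast
        then have "\<beta> < z \<bullet> d \<or> z = C m"
          using not_M[of z "Q m"] z by (auto simp: M_def)
        then show "z \<in> (R y \<inter> {z. \<beta> < z \<bullet> d}) \<union> (R w \<inter> {z. z \<bullet> d \<le> \<beta>})"
          using near(2)[of z s] s z w CM by auto
      qed
      have xw: "x = w \<or> E x w" "cross (P m) (C m) \<longleftrightarrow> {x, w} = {u, v}"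
        using visible_separated[OF x(1) w(1) PR(1) w(2) conv(1,4) lh(1) sepP] by blast+
      have yw: "y = w \<or> E y w" "cross (C m) (Q m) \<longleftrightarrow> {y, w} = {u, v}"
        using visible_separated[OF y(1) w(1) PR(2) w(2) conv(2,3) lh(2) sepQ]
        by (auto simp: cross_commute)
      have xy: "x = y \<or> E x y" "cross (P m) (Q m) \<longleftrightarrow> {x, y} = {u, v}"
        using visible_separated[OF x(1) y(1) PR conv(1,4) lh(1) PQ_clear[OF n3 M0]] by blast+
      have "({x, y} = {u, v}) \<longleftrightarrow> ({x, w} = {u, v}) \<noteq> ({y, w} = {u, v})"
        using cocycle[OF xy(1) xw(1) yw(1)] x(1) y(1) w(1) by blast
      then show False
        using xw(2) yw(2) xy(2) cross_pq PQ[of m] by simp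
    qed
  qed
qed

text \<open>In a closest exceptional pair, every inner point of \<open>X\<close> splits the segment
  into two shorter ones, which are not exceptional. This is the hypothesis of
  \<open>locally_const_if_inner\<close>; the diagonal case shows that the two points differ.\<close>

lemma locally_const_X:
  assumes "p \<in> X" "q \<in> X"
  shows "(p, q) \<in> locally_const"
proof (rule ccontr)
  assume "(p, q) \<notin> locally_const"
  then have "X \<times> X - locally_const \<noteq> {}"
    using assms by blast
  moreover have "compact (X \<times> X - locally_const)"
    by (intro compact_diff compact_Times compact_X open_locally_const)
  moreover have "continuous_on (X \<times> X - locally_const) (\<lambda>z. dist (fst z) (snd z))"
    by (intro continuous_intros)
  ultimately obtain z where z: "z \<in> X \<times> X - locally_const"
    "\<forall>z'\<in>X \<times> X - locally_const. dist (fst z) (snd z) \<le> dist (fst z') (snd z')"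
    using continuous_attains_inf by blast
  obtain a b where "z = (a, b)" by (cases z)
  with z have ab: "a \<in> X" "b \<in> X" "(a, b) \<notin> locally_const"
    and min: "\<And>a' b'. a' \<in> X \<Longrightarrow> b' \<in> X \<Longrightarrow> (a', b') \<notin> locally_const \<Longrightarrow> dist a b \<le> dist a' b'"
    by force+
  have "a \<noteq> b"
    using ab locally_const_diagonal by blast
  moreover have "(a, c) \<in> locally_const \<and> (c, b) \<in> locally_const"
    if "c \<in> X" "c \<in> open_segment a b" for c
    using dist_in_open_segment[OF that(2)] min[of a c] min[of c b] ab that
    by (force simp: dist_commute)
  ultimately show False
    using locally_const_if_inner[of a b] ab by blast
qed

section \<open>Parity between regions and its additivity on triples\<close>

text \<open>With \<open>p\<close> fixed, the parity is a locally constant function on the connected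
  set \<open>R y\<close>.\<close>

lemma cross_region:
  assumes "p \<in> X" "y \<in> V" "q \<in> R y" "q' \<in> R y"
  shows "cross p q = cross p q'"
proof (rule connected_local_const[OF connected_R[OF assms(2)] assms(3,4)])
  have "\<forall>\<^sub>F b in at a within R y. cross p b = cross p a" if "a \<in> R y" for a
    using assms R_subset_X[OF assms(2)] that
    by (intro eventually_cross_eq locally_const_X tendsto_const tendsto_ident_at)
      (auto simp: eventually_at_filter intro!: always_eventually)
  then show "\<forall>a\<in>R y. \<forall>\<^sub>F b in at a within R y. cross p a = cross p b"
    by (simp add: eq_commute)
qed

lemma cross_regions:
  assumes "x \<in> V" "y \<in> V" "p \<in> R x" "p' \<in> R x" "q \<in> R y" "q' \<in> R y"
  shows "cross p q = cross p' q'"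
proof -
  have "p \<in> X" "q' \<in> X" using assms R_subset_X by auto
  then have "cross p q = cross p q'" "cross q' p = cross q' p'"
    using cross_region assms by blast+
  then show ?thesis by (simp add: cross_commute)
qed

text \<open>For \<open>p \<noteq> q\<close> the singletons of the two ends serve as disjoint convex
  separators. For \<open>p = q\<close> there are no gaps.\<close>

lemma cross_clear:
  assumes "x \<in> V" "y \<in> V" "p \<in> R x" "q \<in> R y" "open_segment p q \<inter> X = {}"
  shows "x = y \<or> E x y" "cross p q \<longleftrightarrow> {x, y} = {u, v}"
proof -
  have pq_or: "X \<inter> closed_segment p q \<subseteq> {p, q}"
    using assms(5) by (auto simp: open_segment_def)
  have "(x = y \<or> E x y) \<and> (cross p q \<longleftrightarrow> {x, y} = {u, v})"
  proof (cases "p = q")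
    case True
    then have "x = y" using R_unique assms by blast
    moreover have "\<not> cross p q" using True by (simp add: cross_def gaps_degenerate)
    ultimately show ?thesis using uv by auto
  next
    case False
    then show ?thesis
      using visible_separated[of x y p q "{p}" "{q}"] assms pq_or by blast
  qed
  then show "x = y \<or> E x y" "cross p q \<longleftrightarrow> {x, y} = {u, v}" by auto
qed

text \<open>In a violating triple of least perimeter, a point of \<open>X\<close> inside a side
  would yield another violating triple. Minimality then forces the original triple to be collinear,
  where additivity holds. So all sides are clear, and \<open>cocycle\<close> rules out the
  violation.\<close>

lemma cross_triangle:
  assumes "p \<in> X" "q \<in> X" "r \<in> X"
  shows "cross p r \<longleftrightarrow> cross p q \<noteq> cross q r"
proof (rule ccontr)
  assume bad: "\<not> ?thesis"
  define bad where "bad p q r \<longleftrightarrow> \<not> (cross p r \<longleftrightarrow> cross p q \<noteq> cross q r)" for p q r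
  \<comment> \<open>Badness of a triple depends only on its regions, so the set of bad triples is a finite union of
    compact boxes and one of least perimeter exists.\<close>
  define B where "B = {(x, y, z) \<in> V \<times> V \<times> V. \<exists>p\<in>R x. \<exists>q\<in>R y. \<exists>r\<in>R z. bad p q r}"
  define W where "W = (\<Union>(x, y, z)\<in>B. R x \<times> R y \<times> R z)"
  define perim :: "'b \<times> 'b \<times> 'b \<Rightarrow> real" where
    "perim = (\<lambda>t. dist (fst t) (fst (snd t)) + dist (fst (snd t)) (snd (snd t)) + dist (fst t) (snd (snd t)))"
  have W: "t \<in> W \<longleftrightarrow> (\<exists>p q r. t = (p, q, r) \<and> p \<in> X \<and> q \<in> X \<and> r \<in> X \<and> bad p q r)" for t
  proof
    assume "t \<in> W"
    then obtain x y z p q r p' q' r' where t: "t = (p, q, r)" "x \<in> V" "y \<in> V" "z \<in> V"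
      "p \<in> R x" "q \<in> R y" "r \<in> R z" "p' \<in> R x" "q' \<in> R y" "r' \<in> R z" "bad p' q' r'"
      by (auto simp: W_def B_def)
    then have "bad p q r"
      using cross_regions[of x y p p' q q'] cross_regions[of y z q q' r r'] cross_regions[of x z p p' r r']
      by (simp add: bad_def)
    then show "\<exists>p q r. t = (p, q, r) \<and> p \<in> X \<and> q \<in> X \<and> r \<in> X \<and> bad p q r"
      using t R_subset_X by blast
  next
    assume "\<exists>p q r. t = (p, q, r) \<and> p \<in> X \<and> q \<in> X \<and> r \<in> X \<and> bad p q r"
    then show "t \<in> W"
      by (fastforce simp: W_def B_def X_def)
  qed
  have "finite B"
    by (rule finite_subset[of _ "V \<times> V \<times> V"]) (auto simp: B_def finite_V)
  then have "compact W"
    unfolding W_def by (intro compact_UN) (auto simp: B_def intro!: compact_Times compact_R)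
  moreover have "(p, q, r) \<in> W"
    using bad assms by (auto simp: W bad_def)
  moreover have "continuous_on W perim"
    unfolding perim_def by (intro continuous_intros)
  ultimately have "\<exists>t\<in>W. \<forall>t'\<in>W. perim t \<le> perim t'"
    by (intro continuous_attains_inf) auto
  then obtain a b c where abc: "a \<in> X" "b \<in> X" "c \<in> X" "bad a b c"
    and min: "\<And>a' b' c'. a' \<in> X \<Longrightarrow> b' \<in> X \<Longrightarrow> c' \<in> X \<Longrightarrow> bad a' b' c' \<Longrightarrow>
      perim (a, b, c) \<le> perim (a', b', c')"
    by (auto simp: W)
  \<comment> \<open>\<open>bad\<close> says that an odd number of the three sides have odd parity,
    which does not depend on the order of the points.\<close>
  have bad_perm: "bad p q r \<longleftrightarrow> bad q p r" "bad p q r \<longleftrightarrow> bad q r p" for p q r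
    unfolding bad_def using cross_commute by blast+
  have perim_perm: "perim (p, q, r) = perim (q, p, r)" "perim (p, q, r) = perim (q, r, p)" for p q r
    by (simp_all add: perim_def dist_commute)
  have good_collinear: "\<not> bad p q r" if "q \<in> X" "q \<in> closed_segment p r" for p q r
    unfolding bad_def using cross_split that by blast
  \<comment> \<open>Requiring equality of perimeters, not a particular triple, makes this applicable
    to every relabelling of \<open>a\<close>, \<open>b\<close>, \<open>c\<close>.\<close>
  have clear: "open_segment p q \<inter> X = {}"
    if pqr: "p \<in> X" "q \<in> X" "r \<in> X" "bad p q r" "perim (p, q, r) = perim (a, b, c)" for p q r
  proof (rule ccontr)
    assume "open_segment p q \<inter> X \<noteq> {}"
    then obtain s where s: "s \<in> open_segment p q" "s \<in> X" by blast
    then have s': "s \<in> closed_segment p q" "s \<noteq> p" "s \<noteq> q" by (auto simp: open_segment_def)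
    have len: "dist p q = dist p s + dist s q"
      using s'(1) by (simp add: between_mem_segment[symmetric] between)
    have "cross p q \<longleftrightarrow> cross p s \<noteq> cross s q"
      by (rule cross_split[OF s(2) s'(1)])
    then have "bad p s r \<or> bad s q r"
      using pqr(4) unfolding bad_def by blast
    then show False
    proof
      assume b: "bad p s r"
      \<comment> \<open>Replacing \<open>q\<close> by \<open>s\<close> cannot lower the perimeter,
        so the detour from \<open>s\<close> to \<open>r\<close> through \<open>q\<close> is no
        longer than the direct way. Hence \<open>q\<close> lies between \<open>s\<close> and
        \<open>r\<close>, and then between \<open>p\<close> and \<open>r\<close>.\<close>
      have "perim (p, q, r) \<le> perim (p, s, r)"
        using min[OF pqr(1) s(2) pqr(3) b] pqr(5) by simp
      then have "dist s r = dist s q + dist q r"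
        using len dist_triangle[of s r q] by (simp add: perim_def)
      then have "q \<in> closed_segment s r"
        by (simp add: between_mem_segment[symmetric] between)
      then have "q \<in> closed_segment p r"
        by (rule closed_segment_extend[OF s(1)])
      then show False
        using good_collinear pqr by blast
    next
      assume b: "bad s q r"
      have "perim (p, q, r) \<le> perim (s, q, r)"
        using min[OF s(2) pqr(2,3) b] pqr(5) by simp
      then have "dist s r = dist s p + dist p r"
        using len dist_triangle[of s r p] by (simp add: perim_def dist_commute)
      then have "p \<in> closed_segment s r"
        by (simp add: between_mem_segment[symmetric] between)
      then have "p \<in> closed_segment q r"
        by (rule closed_segment_extend[rotated]) (use s(1) in \<open>simp add: open_segment_commute\<close>)
      then show False
        using good_collinear pqr bad_perm(1) by blast
    qed
  qed
  obtain x y z where xyz: "x \<in> V" "y \<in> V" "z \<in> V" "a \<in> R x" "b \<in> R y" "c \<in> R z"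
    using abc by (auto simp: X_def)
  have "open_segment a b \<inter> X = {}" "open_segment b c \<inter> X = {}" "open_segment a c \<inter> X = {}"
    using clear[of a b c] clear[of b c a] clear[of a c b] abc bad_perm perim_perm by metis+
  then have xy: "x = y \<or> E x y" "cross a b \<longleftrightarrow> {x, y} = {u, v}"
    and yz: "y = z \<or> E y z" "cross b c \<longleftrightarrow> {y, z} = {u, v}"
    and xz: "x = z \<or> E x z" "cross a c \<longleftrightarrow> {x, z} = {u, v}"
    using cross_clear xyz by blast+
  have "z = y \<or> E z y"
    using yz(1) E_sym by blast
  then have "{x, z} = {u, v} \<longleftrightarrow> ({x, y} = {u, v}) \<noteq> ({z, y} = {u, v})"
    by (rule cocycle[OF xz(1) xy(1) _ xyz(1,3,2)])
  then show False
    using abc(4) xy(2) yz(2) xz(2) by (simp add: bad_def insert_commute)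
qed

section \<open>The two-colouring cut exactly by the edge\<close>

text \<open>A sightline may enter and leave its two regions several times. A closest pair on it
  spans a clear segment, and \<open>cross_regions\<close> carries the parity of that segment to
  \<open>p\<close> and \<open>q\<close>.\<close>

lemma cross_edge:
  assumes "x \<in> V" "y \<in> V" "x \<noteq> y" "E x y" "p \<in> R x" "q \<in> R y"
  shows "cross p q \<longleftrightarrow> {x, y} = {u, v}"
proof -
  obtain a0 b0 where ab0: "a0 \<in> R x" "b0 \<in> R y"
    "\<And>w. w \<in> V \<Longrightarrow> w \<noteq> x \<Longrightarrow> w \<noteq> y \<Longrightarrow> closed_segment a0 b0 \<inter> R w = {}"
    using E_iff[OF assms(1-3)] assms(4) by blast
  let ?s = "closed_segment a0 b0"
  obtain a b where ab: "a \<in> ?s \<inter> R x" "b \<in> ?s \<inter> R y"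
    and gap: "open_segment a b \<inter> (?s \<inter> R x \<union> ?s \<inter> R y) = {}"
    using closest_pair_segment_gap[of "?s \<inter> R x" "?s \<inter> R y" a0 b0] compact_R assms ab0
    by (metis Int_iff compact_Int compact_segment ends_in_segment)
  have "open_segment a b \<subseteq> ?s"
    using ab by (meson IntD1 closed_segment_subset convex_closed_segment segment_open_subset_closed subset_trans)
  then have "open_segment a b \<inter> X = {}"
    using gap ab0(3) unfolding X_def by blast
  then have "cross a b \<longleftrightarrow> {x, y} = {u, v}"
    using cross_clear(2) assms ab by blast
  then show ?thesis
    using cross_regions[of x y p a q b] assms ab by blast
qed

text \<open>The colour of a vertex is the parity seen from a fixed point of \<open>R u\<close>. By
  \<open>cross_triangle\<close>, two colours differ exactly when the parity between the two regions
  is odd, and \<open>cross_edge\<close> evaluates this parity on edges.\<close>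

lemma cut_colouring:
  "\<exists>g :: 'a \<Rightarrow> bool. \<forall>x\<in>V. \<forall>y\<in>V. x \<noteq> y \<and> E x y \<longrightarrow> (g x \<noteq> g y \<longleftrightarrow> {x, y} = {u, v})"
proof -
  define pt where "pt x = (SOME p. p \<in> R x)" for x
  have pt: "pt x \<in> R x" if "x \<in> V" for x
    using R_nonempty[OF that] by (simp add: pt_def some_in_eq)
  then have X: "\<And>x. x \<in> V \<Longrightarrow> pt x \<in> X"
    using R_subset_X by blast
  show ?thesis
  proof (intro exI[of _ "\<lambda>x. cross (pt u) (pt x)"] ballI impI)
    fix x y assume xy: "x \<in> V" "y \<in> V" "x \<noteq> y \<and> E x y"
    then have "cross (pt x) (pt y) \<longleftrightarrow> {x, y} = {u, v}"
      using cross_edge pt by blast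
    then show "cross (pt u) (pt x) \<noteq> cross (pt u) (pt y) \<longleftrightarrow> {x, y} = {u, v}"
      using cross_triangle[of "pt u" "pt x" "pt y"] X xy uv by blast
  qed
qed

end

theorem theorem2:
  fixes V :: "'a set" and E :: "'a \<Rightarrow> 'a \<Rightarrow> bool"
  assumes "compact_visibility_graph V E"
    and "E u v"
  shows "is_bridge V E u v \<or> (\<exists>w\<in>V. E u w \<and> E v w)"
proof (rule disjCI)
  assume no_tri: "\<not> (\<exists>w\<in>V. E u w \<and> E v w)"
  obtain R where rep: "visibility_representation V E R" and comp: "\<forall>v\<in>V. compact (R v)"
    and simple: "simple_graph V E"
    using assms(1) by (auto simp: compact_visibility_graph_def)
  have E: "x \<in> V" "y \<in> V" "x \<noteq> y" "E y x" if "E x y" for x y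
    using simple that by (auto simp: simple_graph_def)
  interpret sightline_family V E R u v
  proof
    show "E x y \<longleftrightarrow> (\<exists>a\<in>R x. \<exists>b\<in>R y. \<forall>w\<in>V. w \<noteq> x \<and> w \<noteq> y \<longrightarrow> closed_segment a b \<inter> R w = {})"
      if "x \<in> V" "y \<in> V" "x \<noteq> y" for x y
      using rep that unfolding visibility_representation_def sightline_def by auto
    show "u \<in> V" "v \<in> V" "u \<noteq> v" by (rule E[OF assms(2)])+
    show "\<not> (E u w \<and> E v w)" if "w \<in> V" for w using no_tri that by blast
    show "E x y \<Longrightarrow> E y x" for x y by (rule E(4))
    show "R x \<inter> R y = {}" if "x \<in> V" "y \<in> V" "x \<noteq> y" for x y
      using rep that by (simp add: visibility_representation_def)
    show "connected (R x)" "R x \<noteq> {}" "compact (R x)" if "x \<in> V" for x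
      using rep comp that by (simp_all add: visibility_representation_def)
    show "finite V"
      using simple by (simp add: simple_graph_def)
  qed
  obtain g :: "'a \<Rightarrow> bool" where
    g: "\<forall>x\<in>V. \<forall>y\<in>V. x \<noteq> y \<and> E x y \<longrightarrow> (g x \<noteq> g y \<longleftrightarrow> {x, y} = {u, v})"
    using cut_colouring by (rule exE)
  have "num_components V E < num_components V (delete_edge E u v)"
  \<comment> \<open>Every edge that survives the deletion joins equal colours, whereas
    \<open>u\<close> and \<open>v\<close> have different colours.\<close>
  proof (rule num_components_less[where g = g and u = u and v = v])
    show "g x = g y" if "delete_edge E u v x y" for x y
    proof -
      have "E x y" "{x, y} \<noteq> {u, v}"
        using that by (simp_all add: delete_edge_def)
      then show ?thesis
        using g[rule_format, of x y] E(1-3)[of x y] by blast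
    qed
    show "g u \<noteq> g v"
      using g[rule_format, of u v] uv assms(2) by blast
    show "delete_edge E u v x y \<Longrightarrow> E x y" for x y
      by (simp add: delete_edge_def)
  qed (use finite_V E[OF assms(2)] assms(2) in simp_all)
  then show "is_bridge V E u v"
    using assms(2) by (simp add: is_bridge_def)
qed

end
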